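(* Let $p\ge 5$ be an integer, $\nu=p/2-1$, and let $\Phi_\nu,R_\nu$ be the modified-Bessel potential and ratio defined in the context. Let $(F,A)$ be a paired realization, i.e. real functions on $[0,\infty)$ with $F$ differentiable, $F'=A$ and $A(0)=0$. Let $C\ge 2$ be the number of classes, $\mu_1,\dots,\mu_C\in\mathbb R^p$ unit vectors, $k_j\ge 0$, $c_j\in\mathbb R$, $\tau>0$, $f\in\mathbb R^p$, $y\in\{1,\dots,C\}$, and form $r_j,q_j,\widehat q_j,P,\pi,L_y,\widehat L_y$ as in the context. Suppose $e$ is a finite nonnegative function, integrable on each interval $[\min(k_j,r_j),\max(k_j,r_j)]$, with $|R_\nu(x)-A(x)|\le e(x)$ for every $x$ in each of these intervals. Put $$d_j=\int_{\min(k_j,r_j)}^{\max(k_j,r_j)}e(x)\,dx,\qquad d=\max_j d_j,$$ and let $a_j$ be real numbers with $|R_\nu(r_j)-A(r_j)|\le a_j$ for all $j$. Then $$|\widehat L_y-L_y|\le d_y+d,\qquad \operatorname{TV}(P,\pi)\le\tanh(d/2),$$ $$\lVert\nabla_f\widehat L_y-\nabla_f L_y\rVert\le\frac{2\tanh(d/2)+\max_j a_j+a_y}{\tau}.$$ Moreover, if the approximate top-two score margin $\widehat m$ (largest minus second-largest entry of $\widehat q$) satisfies $\widehat m>2d$, then the exact and approximate predictions agree, i.e. $\arg\max_j q_j=\arg\max_j\widehat q_j$ (both being unique); the same conclusion holds if instead the exact top-two margin (largest minus second-largest entry of $q$) exceeds $2d$.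
   Context: $I_\nu$ is the modified Bessel function of the first kind. For $x>0$, $\Phi_\nu(x)=\log I_\nu(x)-\nu\log x$ and $R_\nu(x)=I_{\nu+1}(x)/I_\nu(x)$, both extended continuously to $x=0$ (so $R_\nu(0)=0$); one has $\Phi_\nu'=R_\nu$. Given the state: $v_j=k_j\mu_j+f/\tau$, $r_j=\lVert v_j\rVert$ (Euclidean norm), exact scores $q_j=\Phi_\nu(r_j)-\Phi_\nu(k_j)+c_j$, approximate scores $\widehat q_j=F(r_j)-F(k_j)+c_j$. Then $P=\operatorname{softmax}(q)$, $\pi=\operatorname{softmax}(\widehat q)$, $L_y=\log\sum_j e^{q_j}-q_y$, $\widehat L_y=\log\sum_j e^{\widehat q_j}-\widehat q_y$. Total variation is $\operatorname{TV}(P,\pi)=\frac12\sum_j|P_j-\pi_j|$. The gradient $\nabla_f$ is the Euclidean gradient with respect to $f$, with $\mu_j,k_j,c_j,\tau$ held fixed. "Top-two margin" counts multiplicity (it is $0$ if the maximum is attained twice). *)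

theory Defs
  imports "HOL-Analysis.Analysis" "HOL-Library.Multiset"
begin

text \<open>Modified Bessel function of the first kind, by its power series. The real power
  \<open>powr\<close> makes this meaningful for \<open>x > 0\<close> only.\<close>

definition besselI :: "real \<Rightarrow> real \<Rightarrow> real" where
  "besselI \<nu> x =
    (\<Sum>m. (x / 2) powr (2 * real m + \<nu>) / (fact m * Gamma (real m + \<nu> + 1)))"

text \<open>Both functions below are continuous extensions to \<open>x = 0\<close>; their values at
  negative arguments are junk.\<close>

definition bessel_potential :: "real \<Rightarrow> real \<Rightarrow> real" where
  "bessel_potential \<nu> x =
    (if x > 0 then ln (besselI \<nu> x) - \<nu> * ln x
     else Lim (at_right 0) (\<lambda>t. ln (besselI \<nu> t) - \<nu> * ln t))"

definition bessel_ratio :: "real \<Rightarrow> real \<Rightarrow> real" where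
  "bessel_ratio \<nu> x =
    (if x > 0 then besselI (\<nu> + 1) x / besselI \<nu> x
     else Lim (at_right 0) (\<lambda>t. besselI (\<nu> + 1) t / besselI \<nu> t))"

definition radius ::
  "('c \<Rightarrow> 'a::real_normed_vector) \<Rightarrow> ('c \<Rightarrow> real) \<Rightarrow> real \<Rightarrow> 'a \<Rightarrow> 'c \<Rightarrow> real" where
  "radius \<mu> k \<tau> f j = norm (k j *\<^sub>R \<mu> j + f /\<^sub>R \<tau>)"

text \<open>The class scores built from a potential \<open>G\<close>: the exact scores take \<open>G\<close> to be the
  Bessel potential, the approximate scores take its surrogate.\<close>

definition scores ::
  "(real \<Rightarrow> real) \<Rightarrow> ('c \<Rightarrow> 'a::real_normed_vector) \<Rightarrow> ('c \<Rightarrow> real) \<Rightarrow> ('c \<Rightarrow> real) \<Rightarrow> real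
    \<Rightarrow> 'a \<Rightarrow> 'c \<Rightarrow> real" where
  "scores G \<mu> k c \<tau> f j = G (radius \<mu> k \<tau> f j) - G (k j) + c j"

definition softmax :: "('c::finite \<Rightarrow> real) \<Rightarrow> 'c \<Rightarrow> real" where
  "softmax s j = exp (s j) / (\<Sum>i\<in>UNIV. exp (s i))"

definition cross_entropy :: "('c::finite \<Rightarrow> real) \<Rightarrow> 'c \<Rightarrow> real" where
  "cross_entropy s y = ln (\<Sum>j\<in>UNIV. exp (s j)) - s y"

definition total_variation :: "('c::finite \<Rightarrow> real) \<Rightarrow> ('c \<Rightarrow> real) \<Rightarrow> real" where
  "total_variation P Q = (1 / 2) * (\<Sum>j\<in>UNIV. \<bar>P j - Q j\<bar>)"

text \<open>Largest minus second-largest entry; working with the multiset of entries makes a tie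
  for the maximum give margin \<open>0\<close>. Meaningful only if there are at least two entries.\<close>

definition top_two_margin :: "('c::finite \<Rightarrow> real) \<Rightarrow> real" where
  "top_two_margin s =
    (let M = image_mset s (mset_set UNIV); m = Max (set_mset M)
     in m - Max (set_mset (M - {#m#})))"

definition argmax_set :: "('c \<Rightarrow> real) \<Rightarrow> 'c set" where
  "argmax_set s = {j. is_arg_max s (\<lambda>_. True) j}"

end

theory Submission
  imports Defs
begin

text \<open>Writing \<open>I\<^sub>\<nu>(x) = (x/2)\<^sup>\<nu> h\<^sub>\<nu>(x\<^sup>2/4)\<close> with the entire function
  \<open>h\<^sub>\<nu>(t) = \<Sum>\<^sub>m t\<^sup>m / (m! \<Gamma>(m+\<nu>+1))\<close>, one has \<open>h\<^sub>\<nu>' = h\<^sub>\<nu>\<^sub>+\<^sub>1\<close>, hence \<open>\<Phi>\<^sub>\<nu>' = R\<^sub>\<nu>\<close> on \<open>[0,\<infinity>)\<close>, and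
  integrating \<open>R\<^sub>\<nu> - A\<close> bounds every score error by \<open>d\<^sub>j\<close>. Score errors of size \<open>d\<close> change the odds
  of any event by a factor of at most \<open>e\<^sup>2\<^sup>d\<close>, which gives the total variation bound, and the score
  differences by at most \<open>2d\<close>, which gives the stability of the prediction.
  The score gradients are \<open>R\<^sub>\<nu>(r\<^sub>j) v\<^sub>j / (r\<^sub>j \<tau>)\<close>, of norm at most \<open>1/\<tau>\<close> because \<open>0 \<le> R\<^sub>\<nu> \<le> 1\<close>.\<close>

subsection \<open>The Bessel potential and ratio\<close>

definition bessel_coeff :: "real \<Rightarrow> nat \<Rightarrow> real" where
  "bessel_coeff \<nu> m = 1 / (fact m * Gamma (real m + \<nu> + 1))"

text \<open>The entire function \<open>h\<^sub>\<nu>\<close>. Free of real powers, it is smooth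
  across 0 and so yields the values at \<open>x = 0\<close>.\<close>

definition bessel_series :: "real \<Rightarrow> real \<Rightarrow> real" where
  "bessel_series \<nu> t = (\<Sum>m. bessel_coeff \<nu> m * t ^ m)"

lemma bessel_coeff_pos:
  assumes "\<nu> \<ge> 0"
  shows "bessel_coeff \<nu> m > 0"
  using assms by (simp add: bessel_coeff_def Gamma_real_pos)

text \<open>Each step multiplies by \<open>real m + \<nu> + 1\<close>, which is at least 1. The
  bound lets the exponential series dominate the Bessel series.\<close>

lemma Gamma_add_nat_ge:
  assumes "\<nu> \<ge> 0"
  shows "Gamma (real m + \<nu> + 1) \<ge> Gamma (\<nu> + 1)"
proof (induction m)
  case (Suc m)
  have "Gamma (real (Suc m) + \<nu> + 1) = (real m + \<nu> + 1) * Gamma (real m + \<nu> + 1)"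
    unfolding of_nat_Suc using assms Gamma_plus1[of "real m + \<nu> + 1"]
    by (subst Gamma_plus1[symmetric]) (auto simp: add_ac elim!: nonpos_Ints_cases)
  moreover have "Gamma (real m + \<nu> + 1) > 0"
    using assms by (simp add: Gamma_real_pos)
  ultimately have "Gamma (real (Suc m) + \<nu> + 1) \<ge> Gamma (real m + \<nu> + 1)"
    using assms mult_right_mono[of 1 "real m + \<nu> + 1" "Gamma (real m + \<nu> + 1)"] by simp
  with Suc show ?case by linarith
qed simp

lemma summable_bessel_series:
  assumes "\<nu> \<ge> 0"
  shows "summable (\<lambda>m. bessel_coeff \<nu> m * t ^ m)"
proof (rule summable_comparison_test)
  have G: "Gamma (\<nu> + 1) > 0" using assms by (simp add: Gamma_real_pos)
  have "norm (bessel_coeff \<nu> m * t ^ m) \<le> (1 / Gamma (\<nu> + 1)) * (inverse (fact m) * \<bar>t\<bar> ^ m)" for m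
  proof -
    have "bessel_coeff \<nu> m \<le> 1 / (fact m * Gamma (\<nu> + 1))"
      unfolding bessel_coeff_def
      using Gamma_add_nat_ge[OF assms, of m] G
      by (intro divide_left_mono mult_left_mono) (auto intro!: mult_pos_pos)
    hence "bessel_coeff \<nu> m * \<bar>t\<bar> ^ m \<le> 1 / (fact m * Gamma (\<nu> + 1)) * \<bar>t\<bar> ^ m"
      by (rule mult_right_mono) simp
    thus ?thesis
      using bessel_coeff_pos[OF assms, of m] by (simp add: abs_mult power_abs field_simps)
  qed
  thus "\<exists>N. \<forall>m\<ge>N. norm (bessel_coeff \<nu> m * t ^ m)
      \<le> (1 / Gamma (\<nu> + 1)) * (inverse (fact m) * \<bar>t\<bar> ^ m)" by blast
  show "summable (\<lambda>m. (1 / Gamma (\<nu> + 1)) * (inverse (fact m) * \<bar>t\<bar> ^ m))"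
    by (intro summable_mult summable_exp)
qed

text \<open>The term of index 0 is positive even at \<open>t = 0\<close>, where all the others
  vanish.\<close>

lemma bessel_series_pos:
  assumes "\<nu> \<ge> 0" "t \<ge> 0"
  shows "bessel_series \<nu> t > 0"
  unfolding bessel_series_def
  using assms
  by (intro suminf_pos2[where i = 0] summable_bessel_series)
     (auto simp: bessel_coeff_pos intro!: mult_nonneg_nonneg less_imp_le[OF bessel_coeff_pos])

text \<open>Raising the order and raising the index shift the Gamma argument alike; hence termwise
  differentiation gives the series of order \<open>\<nu> + 1\<close>.\<close>

lemma bessel_coeff_Suc:
  "bessel_coeff (\<nu> + 1) m = real (Suc m) * bessel_coeff \<nu> (Suc m)"
  by (simp add: bessel_coeff_def add_ac del: of_nat_Suc) (simp add: add_ac)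

text \<open>A second form of the same coefficient, from the functional equation of Gamma; paired
  with \<open>bessel_coeff_Suc\<close> it links neighbouring coefficients of order
  \<open>\<nu>\<close>.\<close>

lemma bessel_coeff_plus1:
  assumes "\<nu> \<ge> 0"
  shows "bessel_coeff (\<nu> + 1) m = bessel_coeff \<nu> m / (real m + \<nu> + 1)"
proof -
  have "Gamma (real m + \<nu> + 1 + 1) = (real m + \<nu> + 1) * Gamma (real m + \<nu> + 1)"
    using assms by (intro Gamma_plus1) (auto elim!: nonpos_Ints_cases)
  thus ?thesis by (simp add: bessel_coeff_def add_ac)
qed

lemma bessel_series_has_real_derivative:
  assumes "\<nu> \<ge> 0"
  shows "(bessel_series \<nu> has_real_derivative bessel_series (\<nu> + 1) t) (at t)"
proof -
  have "diffs (bessel_coeff \<nu>) = bessel_coeff (\<nu> + 1)"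
    by (simp add: diffs_def bessel_coeff_Suc fun_eq_iff)
  thus ?thesis
    using termdiffs_strong_converges_everywhere[of "bessel_coeff \<nu>" t]
      summable_bessel_series[OF assms]
    by (simp add: bessel_series_def[abs_def])
qed

lemma besselI_eq_bessel_series:
  assumes "\<nu> \<ge> 0" "x > 0"
  shows "besselI \<nu> x = (x / 2) powr \<nu> * bessel_series \<nu> (x\<^sup>2 / 4)"
proof -
  have "(x / 2) powr (2 * real m + \<nu>) / (fact m * Gamma (real m + \<nu> + 1))
      = (x / 2) powr \<nu> * (bessel_coeff \<nu> m * (x\<^sup>2 / 4) ^ m)" for m
  proof -
    have "(x / 2) powr (2 * real m) = (x / 2) ^ (2 * m)"
      using assms powr_realpow[of "x / 2" "2 * m"] by simp
    also have "\<dots> = (x\<^sup>2 / 4) ^ m" by (simp add: power_mult power_divide)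
    finally show ?thesis by (simp add: powr_add bessel_coeff_def)
  qed
  thus ?thesis
    using suminf_mult[OF summable_bessel_series[OF assms(1)], of "(x / 2) powr \<nu>"]
    by (simp add: besselI_def bessel_series_def)
qed

text \<open>The power prefactor contributes \<open>\<nu> * ln x\<close>, which cancels. What remains
  is continuous at 0, so it also evaluates the \<open>Lim\<close> there.\<close>

lemma bessel_potential_eq:
  assumes "\<nu> \<ge> 0" "x \<ge> 0"
  shows "bessel_potential \<nu> x = ln (bessel_series \<nu> (x\<^sup>2 / 4)) - \<nu> * ln 2"
proof -
  let ?g = "\<lambda>x. ln (bessel_series \<nu> (x\<^sup>2 / 4)) - \<nu> * ln 2"
  have eq: "ln (besselI \<nu> x) - \<nu> * ln x = ?g x" if "x > 0" for x
    using that bessel_series_pos[OF assms(1), of "x\<^sup>2 / 4"]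
    by (simp add: besselI_eq_bessel_series[OF assms(1)] ln_mult ln_powr ln_div algebra_simps)
  show ?thesis
  proof (cases "x > 0")
    case True
    thus ?thesis using eq by (simp add: bessel_potential_def)
  next
    case False
    have "isCont (bessel_series \<nu>) 0"
      using bessel_series_has_real_derivative[OF assms(1)] DERIV_isCont by blast
    moreover have "((\<lambda>x::real. x\<^sup>2 / 4) \<longlongrightarrow> 0) (at_right 0)"
      by (auto intro!: tendsto_eq_intros)
    ultimately have "((\<lambda>x. bessel_series \<nu> (x\<^sup>2 / 4)) \<longlongrightarrow> bessel_series \<nu> 0) (at_right 0)"
      by (rule isCont_tendsto_compose)
    hence "(?g \<longlongrightarrow> ?g 0) (at_right 0)"
      using bessel_series_pos[OF assms(1), of 0] by (auto intro!: tendsto_intros)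
    moreover have "eventually (\<lambda>x. ?g x = ln (besselI \<nu> x) - \<nu> * ln x) (at_right 0)"
      by (rule eventually_at_rightI[of 0 1]) (simp_all add: eq)
    ultimately have "((\<lambda>x. ln (besselI \<nu> x) - \<nu> * ln x) \<longlongrightarrow> ?g 0) (at_right 0)"
      by (rule Lim_transform_eventually)
    from tendsto_Lim[OF _ this] False assms show ?thesis
      by (simp add: bessel_potential_def)
  qed
qed

text \<open>The prefactors of the two orders have quotient \<open>x / 2\<close>, which makes the
  limit at 0 vanish.\<close>

lemma bessel_ratio_eq:
  assumes "\<nu> \<ge> 0" "x \<ge> 0"
  shows "bessel_ratio \<nu> x = x / 2 * bessel_series (\<nu> + 1) (x\<^sup>2 / 4) / bessel_series \<nu> (x\<^sup>2 / 4)"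
proof -
  let ?g = "\<lambda>x. x / 2 * bessel_series (\<nu> + 1) (x\<^sup>2 / 4) / bessel_series \<nu> (x\<^sup>2 / 4)"
  have eq: "besselI (\<nu> + 1) x / besselI \<nu> x = ?g x" if "x > 0" for x
    using that assms(1) by (simp add: besselI_eq_bessel_series powr_add)
  show ?thesis
  proof (cases "x > 0")
    case True
    thus ?thesis using eq by (simp add: bessel_ratio_def)
  next
    case False
    have c: "isCont (bessel_series \<nu>) 0" "isCont (bessel_series (\<nu> + 1)) 0"
      using bessel_series_has_real_derivative[of \<nu>] bessel_series_has_real_derivative[of "\<nu> + 1"]
        assms(1) DERIV_isCont by force+
    have l: "((\<lambda>x::real. x\<^sup>2 / 4) \<longlongrightarrow> 0) (at_right 0)"
      by (auto intro!: tendsto_eq_intros)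
    have "(?g \<longlongrightarrow> 0 / 2 * bessel_series (\<nu> + 1) 0 / bessel_series \<nu> 0) (at_right 0)"
      using bessel_series_pos[OF assms(1), of 0]
      by (intro tendsto_divide tendsto_mult isCont_tendsto_compose[OF c(1) l]
          isCont_tendsto_compose[OF c(2) l] tendsto_ident_at tendsto_const) auto
    moreover have "eventually (\<lambda>x. ?g x = besselI (\<nu> + 1) x / besselI \<nu> x) (at_right 0)"
      by (rule eventually_at_rightI[of 0 1]) (simp_all add: eq)
    ultimately have "((\<lambda>x. besselI (\<nu> + 1) x / besselI \<nu> x)
        \<longlongrightarrow> 0 / 2 * bessel_series (\<nu> + 1) 0 / bessel_series \<nu> 0) (at_right 0)"
      by (rule Lim_transform_eventually)
    from tendsto_Lim[OF _ this] False assms show ?thesis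
      by (simp add: bessel_ratio_def)
  qed
qed

text \<open>The inner derivative \<open>x / 2\<close> of \<open>x\<^sup>2 / 4\<close> supplies the
  factor of the ratio. The derivative is one-sided at 0 because negative arguments carry junk
  values.\<close>

lemma bessel_potential_has_real_derivative:
  assumes "\<nu> \<ge> 0" "x \<ge> 0"
  shows "(bessel_potential \<nu> has_real_derivative bessel_ratio \<nu> x) (at x within {0..})"
proof (rule has_field_derivative_transform_within[where d = 1 and
      f = "\<lambda>x. ln (bessel_series \<nu> (x\<^sup>2 / 4)) - \<nu> * ln 2"])
  have "((\<lambda>x. x\<^sup>2 / 4) has_real_derivative x / 2) (at x within {0..})"
    by (auto intro!: derivative_eq_intros)
  hence "((\<lambda>x. bessel_series \<nu> (x\<^sup>2 / 4)) has_real_derivative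
      bessel_series (\<nu> + 1) (x\<^sup>2 / 4) * (x / 2)) (at x within {0..})"
    by (rule DERIV_chain2[OF bessel_series_has_real_derivative[OF assms(1)]])
  thus "((\<lambda>x. ln (bessel_series \<nu> (x\<^sup>2 / 4)) - \<nu> * ln 2) has_real_derivative bessel_ratio \<nu> x)
      (at x within {0..})"
    unfolding bessel_ratio_eq[OF assms]
    using bessel_series_pos[OF assms(1), of "x\<^sup>2 / 4"]
    by (auto intro!: derivative_eq_intros simp: field_simps)
qed (use assms in \<open>auto simp: bessel_potential_eq\<close>)

lemma bessel_ratio_zero:
  assumes "\<nu> \<ge> 0"
  shows "bessel_ratio \<nu> 0 = 0"
  using assms by (simp add: bessel_ratio_eq)

text \<open>With \<open>b\<^sub>m\<close> the coefficients of \<open>h\<^sub>\<nu>\<close> and \<open>c\<^sub>m\<close> those of \<open>h\<^sub>\<nu>\<^sub>+\<^sub>1\<close>, one has \<open>c\<^sub>m\<^sup>2 \<le> b\<^sub>m b\<^sub>m\<^sub>+\<^sub>1\<close>;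
  by AM-GM each odd term \<open>c\<^sub>m s\<^sup>2\<^sup>m\<^sup>+\<^sup>1\<close> is at most the mean of the two neighbouring even terms.\<close>

lemma bessel_series_plus1_le:
  assumes "\<nu> \<ge> 0" "s \<ge> 0"
  shows "s * bessel_series (\<nu> + 1) (s\<^sup>2) \<le> bessel_series \<nu> (s\<^sup>2)"
proof -
  define B where "B m = bessel_coeff \<nu> m * (s\<^sup>2) ^ m" for m
  have B0: "B m \<ge> 0" for m
    using bessel_coeff_pos[OF assms(1), of m] assms(2) by (simp add: B_def)
  have sB: "summable B" unfolding B_def by (rule summable_bessel_series[OF assms(1)])
  have sB': "summable (\<lambda>m. B (Suc m))" using sB by (simp add: summable_Suc_iff)
  have le: "s * (bessel_coeff (\<nu> + 1) m * (s\<^sup>2) ^ m) \<le> (B m + B (Suc m)) / 2" for m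
  proof -
    let ?t = "s * (bessel_coeff (\<nu> + 1) m * (s\<^sup>2) ^ m)"
    have "?t\<^sup>2 = bessel_coeff (\<nu> + 1) m * bessel_coeff (\<nu> + 1) m * ((s\<^sup>2) ^ m * (s\<^sup>2) ^ Suc m)"
      by (simp add: power2_eq_square power_mult_distrib algebra_simps)
    \<comment> \<open>Each of the two coefficient identities rewrites one factor; the quotient left
      over is at most 1 since \<open>\<nu> \<ge> 0\<close>.\<close>
    also have "\<dots> = (bessel_coeff \<nu> m / (real m + \<nu> + 1)) * (real (Suc m) * bessel_coeff \<nu> (Suc m))
        * ((s\<^sup>2) ^ m * (s\<^sup>2) ^ Suc m)"
      using bessel_coeff_plus1[OF assms(1), of m] bessel_coeff_Suc[of \<nu> m] by simp
    also have "\<dots> = (real (Suc m) / (real m + \<nu> + 1)) * (B m * B (Suc m))"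
      by (simp add: B_def)
    also have "\<dots> \<le> 1 * (B m * B (Suc m))"
      using assms(1) B0 by (intro mult_right_mono) (auto simp: divide_simps)
    finally have "?t\<^sup>2 \<le> B m * B (Suc m)" by simp
    also have "\<dots> \<le> ((B m + B (Suc m)) / 2)\<^sup>2"
      using zero_le_power2[of "B m - B (Suc m)"] by (simp add: power2_eq_square field_simps)
    finally show ?thesis
      by (rule power2_le_imp_le) (simp add: B0)
  qed
  have "s * bessel_series (\<nu> + 1) (s\<^sup>2) = (\<Sum>m. s * (bessel_coeff (\<nu> + 1) m * (s\<^sup>2) ^ m))"
    unfolding bessel_series_def using assms(1)
    by (intro suminf_mult[symmetric] summable_bessel_series) simp
  also have "\<dots> \<le> (\<Sum>m. (B m + B (Suc m)) / 2)"
    using assms(1) sB sB'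
    by (intro suminf_le le summable_mult summable_bessel_series summable_divide summable_add) auto
  also have "\<dots> = ((\<Sum>m. B m) + (\<Sum>m. B (Suc m))) / 2"
    using sB sB' by (simp add: suminf_divide suminf_add summable_add)
  \<comment> \<open>The shifted sum misses only the nonnegative term \<open>B 0\<close>.\<close>
  also have "\<dots> \<le> (\<Sum>m. B m)"
    using suminf_split_head[OF sB] B0[of 0] by simp
  finally show ?thesis by (simp add: bessel_series_def B_def[abs_def])
qed

text \<open>The upper bound is the series inequality at \<open>s = x / 2\<close>.\<close>

lemma bessel_ratio_bounds:
  assumes "\<nu> \<ge> 0" "x \<ge> 0"
  shows "0 \<le> bessel_ratio \<nu> x" "bessel_ratio \<nu> x \<le> 1"
proof -
  have p: "bessel_series \<nu> (x\<^sup>2 / 4) > 0" "bessel_series (\<nu> + 1) (x\<^sup>2 / 4) > 0"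
    using assms by (auto intro!: bessel_series_pos)
  thus "0 \<le> bessel_ratio \<nu> x" using assms by (simp add: bessel_ratio_eq)
  have "x / 2 * bessel_series (\<nu> + 1) (x\<^sup>2 / 4) \<le> bessel_series \<nu> (x\<^sup>2 / 4)"
    using bessel_series_plus1_le[OF assms(1), of "x / 2"] assms(2) by (simp add: power_divide)
  thus "bessel_ratio \<nu> x \<le> 1" using p assms by (simp add: bessel_ratio_eq)
qed

lemma bessel_ratio_abs_le_1:
  assumes "\<nu> \<ge> 0" "x \<ge> 0"
  shows "\<bar>bessel_ratio \<nu> x\<bar> \<le> 1"
  using bessel_ratio_bounds[OF assms] by simp

subsection \<open>Gradients of the scores and of the loss\<close>

text \<open>At the origin \<open>sgn v = 0\<close>, and the norm itself is not differentiable there: this is where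
  \<open>B 0 = 0\<close> is needed.\<close>

lemma GDERIV_radial:
  fixes v :: "'a::real_inner"
  assumes "(G has_real_derivative B (norm v)) (at (norm v) within {0..})" "B 0 = 0"
  shows "GDERIV (\<lambda>v. G (norm v)) v :> B (norm v) *\<^sub>R sgn v"
proof (cases "v = 0")
  case False
  have n: "(norm has_derivative (\<lambda>h. h \<bullet> sgn v)) (at v)"
    using has_derivative_norm[OF False] by (simp add: inner_commute)
  \<comment> \<open>Norms lie in \<open>{0..}\<close>, so the one-sided derivative of
    \<open>G\<close> is enough for the chain rule.\<close>
  have "(G has_derivative (*) (B (norm v))) (at (norm v) within norm ` UNIV)"
    by (rule has_derivative_subset[OF assms(1)[unfolded has_field_derivative_def]]) auto
  from has_derivative_in_compose[OF n this] show ?thesis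
    by (simp add: gderiv_def)
next
  case True
  have "(G has_derivative (\<lambda>h. 0)) (at 0 within {0..})"
    using assms True by (simp add: has_field_derivative_def mult_zero_left[abs_def])
  hence G: "((\<lambda>y. norm (G y - G 0) / norm y) \<longlongrightarrow> 0) (at 0 within {0..})"
    by (simp add: has_derivative_iff_norm)
  \<comment> \<open>Nonzero vectors have nonzero norm, so the scalar difference quotient can be
    pulled back along the norm.\<close>
  have "filterlim norm (at 0 within {0..}) (at (0::'a))"
    unfolding filterlim_at by (auto simp: eventually_at intro!: tendsto_eq_intros exI[of _ 1])
  from filterlim_compose[OF G this]
  have "((\<lambda>y::'a. norm (G (norm y) - G 0) / norm y) \<longlongrightarrow> 0) (at 0)" by simp
  thus ?thesis
    using True by (simp add: gderiv_def has_derivative_iff_norm)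
qed

text \<open>Chain rule along an affine map; \<open>G (k j)\<close> and \<open>c j\<close> are
  constants. The general pair \<open>G\<close>, \<open>B\<close> serves exact and approximate scores
  alike.\<close>

lemma GDERIV_scores:
  fixes \<mu> :: "'c \<Rightarrow> 'a::real_inner"
  assumes G: "\<And>x. x \<ge> 0 \<Longrightarrow> (G has_real_derivative B x) (at x within {0..})" and "B 0 = 0"
  shows "GDERIV (\<lambda>u. scores G \<mu> k c \<tau> u j) f :>
    (B (radius \<mu> k \<tau> f j) / \<tau>) *\<^sub>R sgn (k j *\<^sub>R \<mu> j + f /\<^sub>R \<tau>)"
proof -
  let ?v = "\<lambda>u. k j *\<^sub>R \<mu> j + u /\<^sub>R \<tau>"
  have "((\<lambda>v. G (norm v)) has_derivative (\<lambda>h. h \<bullet> (B (norm (?v f)) *\<^sub>R sgn (?v f)))) (at (?v f))"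
    using GDERIV_radial[where B = B, OF G[of "norm (?v f)"] \<open>B 0 = 0\<close>] by (simp add: gderiv_def)
  moreover have "(?v has_derivative (\<lambda>h. h /\<^sub>R \<tau>)) (at f)"
    by (auto intro!: derivative_eq_intros)
  ultimately have "((\<lambda>u. G (norm (?v u))) has_derivative
      (\<lambda>h. (h /\<^sub>R \<tau>) \<bullet> (B (norm (?v f)) *\<^sub>R sgn (?v f)))) (at f)"
    using has_derivative_compose by blast
  hence "((\<lambda>u. G (norm (?v u)) - G (k j) + c j) has_derivative
      (\<lambda>h. (h /\<^sub>R \<tau>) \<bullet> (B (norm (?v f)) *\<^sub>R sgn (?v f)))) (at f)"
    by (auto intro!: derivative_eq_intros)
  thus ?thesis
    by (simp add: gderiv_def scores_def radius_def divide_inverse mult_ac)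
qed

lemma sum_exp_pos:
  fixes s :: "'c::finite \<Rightarrow> real"
  shows "(\<Sum>j\<in>UNIV. exp (s j)) > 0"
  by (intro sum_pos) auto

lemma GDERIV_cross_entropy:
  fixes s :: "'a::real_inner \<Rightarrow> 'c::finite \<Rightarrow> real"
  assumes "\<And>j. GDERIV (\<lambda>u. s u j) f :> g j"
  shows "GDERIV (\<lambda>u. cross_entropy (s u) y) f :> (\<Sum>j\<in>UNIV. softmax (s f) j *\<^sub>R g j) - g y"
proof -
  have s: "((\<lambda>u. s u j) has_derivative (\<lambda>h. h \<bullet> g j)) (at f)" for j
    using assms by (simp add: gderiv_def)
  have "((\<lambda>u. exp (s u j)) has_derivative (\<lambda>h. exp (s f j) * (h \<bullet> g j))) (at f)" for j
    using has_derivative_exp[OF s[of j]] by (simp add: mult_ac)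
  hence "((\<lambda>u. \<Sum>j\<in>UNIV. exp (s u j)) has_derivative
      (\<lambda>h. \<Sum>j\<in>UNIV. exp (s f j) * (h \<bullet> g j))) (at f)"
    by (intro has_derivative_sum) auto
  from has_derivative_diff[OF has_derivative_ln[OF sum_exp_pos this] s[of y]]
  have "((\<lambda>u. cross_entropy (s u) y) has_derivative
      (\<lambda>h. (\<Sum>j\<in>UNIV. exp (s f j) * (h \<bullet> g j)) * inverse (\<Sum>j\<in>UNIV. exp (s f j)) - h \<bullet> g y)) (at f)"
    unfolding cross_entropy_def by simp
  thus ?thesis
    unfolding gderiv_def
    by (simp add: inner_diff_right inner_sum_right softmax_def divide_inverse mult_ac
        sum_distrib_left)
qed

subsection \<open>Perturbation of scores\<close>

lemma softmax_nonneg: "softmax s j \<ge> 0"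
  by (simp add: softmax_def sum_nonneg)

lemma sum_softmax: "(\<Sum>j\<in>UNIV. softmax s j) = 1"
  using sum_exp_pos[of s] by (simp add: softmax_def flip: sum_divide_distrib)

text \<open>Log-sum-exp is monotone and commutes with adding a constant, so it moves by at most
  \<open>d\<close>; the score of class \<open>y\<close> adds its own error
  \<open>D y\<close>.\<close>

lemma cross_entropy_perturb:
  assumes "\<And>j. \<bar>s' j - s j\<bar> \<le> D j" "\<And>j. D j \<le> d"
  shows "\<bar>cross_entropy s' y - cross_entropy s y\<bar> \<le> D y + d"
proof -
  have lse: "ln (\<Sum>j\<in>UNIV. exp (t' j)) \<le> d + ln (\<Sum>j\<in>UNIV. exp (t j))"
    if "\<And>j. t' j \<le> d + t j" for t t' :: "'a \<Rightarrow> real"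
  proof -
    have "(\<Sum>j\<in>UNIV. exp (t' j)) \<le> (\<Sum>j\<in>UNIV. exp d * exp (t j))"
      using that by (intro sum_mono) (simp flip: exp_add)
    also have "\<dots> = exp d * (\<Sum>j\<in>UNIV. exp (t j))" by (simp add: sum_distrib_left)
    finally have "ln (\<Sum>j\<in>UNIV. exp (t' j)) \<le> ln (exp d * (\<Sum>j\<in>UNIV. exp (t j)))"
      using sum_exp_pos[of t'] by simp
    thus ?thesis using sum_exp_pos[of t] by (simp add: ln_mult)
  qed
  have "s' j \<le> d + s j" "s j \<le> d + s' j" for j
    using assms(1)[of j] assms(2)[of j] by linarith+
  hence "\<bar>ln (\<Sum>j\<in>UNIV. exp (s' j)) - ln (\<Sum>j\<in>UNIV. exp (s j))\<bar> \<le> d"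
    using lse[of s' s] lse[of s s'] by fastforce
  thus ?thesis using assms(1)[of y] unfolding cross_entropy_def by linarith
qed

section \<open>Total variation of two softmax distributions\<close>

text \<open>This is the form \<open>(w - 1) / (w + 1)\<close> with \<open>w = exp d\<close>.\<close>

lemma tanh_half: "tanh (d / 2 :: real) = (exp d - 1) / (exp d + 1)"
proof -
  have "1 + exp d > 0" "exp d + exp d * exp d > 0" by (simp_all add: add_pos_pos)
  thus ?thesis
    by (simp add: tanh_real_altdef exp_minus divide_simps algebra_simps)
qed

text \<open>Here \<open>w\<^sup>2\<close> bounds the ratio of the odds \<open>a'/b'\<close> and \<open>a/b\<close>; the extremal case is \<open>a/b = 1/w\<close>.\<close>

lemma proportion_diff_le:
  fixes a b a' b' w :: real
  assumes "a \<ge> 0" "b \<ge> 0" "a' \<ge> 0" "b' \<ge> 0" "a + b > 0" "a' + b' > 0" "w \<ge> 1"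
    and odds: "a' * b \<le> w\<^sup>2 * (a * b')"
  shows "a' / (a' + b') - a / (a + b) \<le> (w - 1) / (w + 1)"
proof -
  \<comment> \<open>The numerator of the difference is \<open>u\<^sup>2 - v\<^sup>2\<close>. The
    odds bound controls \<open>u - v\<close> by \<open>u + v\<close>, and Cauchy-Schwarz bounds the
    square of \<open>u + v\<close> by the common denominator.\<close>
  define u where "u = sqrt (a' * b)"
  define v where "v = sqrt (a * b')"
  have uv: "u \<ge> 0" "v \<ge> 0" "u\<^sup>2 = a' * b" "v\<^sup>2 = a * b'"
    using assms by (simp_all add: u_def v_def)
  have "u \<le> w * v"
    by (rule power2_le_imp_le) (use odds uv \<open>w \<ge> 1\<close> in \<open>simp_all add: power_mult_distrib\<close>)
  hence "(u - v) * (w + 1) \<le> (w - 1) * (u + v)" by (simp add: algebra_simps)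
  hence "(u + v) * ((u - v) * (w + 1)) \<le> (u + v) * ((w - 1) * (u + v))"
    using uv by (intro mult_left_mono) auto
  hence "(u\<^sup>2 - v\<^sup>2) * (w + 1) \<le> (w - 1) * (u + v)\<^sup>2"
    by (simp add: power2_eq_square algebra_simps)
  also have "\<dots> \<le> (w - 1) * ((a' + b') * (a + b))"
  proof (intro mult_left_mono)
    \<comment> \<open>Regrouping under the roots lets AM-GM produce exactly the terms missing from
      the expanded product.\<close>
    have "u * v = sqrt (a * a') * sqrt (b * b')"
      by (simp add: u_def v_def real_sqrt_mult mult_ac)
    also have "2 * \<dots> \<le> a * a' + b * b'"
      using assms sum_squares_bound[of "sqrt (a * a')" "sqrt (b * b')"] by simp
    finally show "(u + v)\<^sup>2 \<le> (a' + b') * (a + b)"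
      using uv by (simp add: power2_sum algebra_simps)
  qed (use assms in auto)
  finally have "(a' * b - a * b') * (w + 1) \<le> (w - 1) * ((a' + b') * (a + b))"
    using uv by simp
  moreover have "a' / (a' + b') - a / (a + b) = (a' * b - a * b') / ((a' + b') * (a + b))"
    using assms by (simp add: field_simps)
  ultimately show ?thesis
    using assms by (simp add: divide_simps mult_ac)
qed

lemma total_variation_softmax_le:
  fixes s s' :: "'c::finite \<Rightarrow> real"
  assumes "\<And>j. \<bar>s' j - s j\<bar> \<le> d"
  shows "total_variation (softmax s) (softmax s') \<le> tanh (d / 2)"
proof -
  \<comment> \<open>Both distributions sum to 1, so the gain on \<open>S\<close> equals the loss on
    its complement and total variation is the gain on this single event.\<close>
  define S where "S = {j. softmax s j < softmax s' j}"
  have d0: "d \<ge> 0" using assms[of undefined] by linarith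
  define a b a' b' where "a = (\<Sum>j\<in>S. exp (s j))" and "b = (\<Sum>j\<in>-S. exp (s j))"
    and "a' = (\<Sum>j\<in>S. exp (s' j))" and "b' = (\<Sum>j\<in>-S. exp (s' j))"
  note defs = a_def b_def a'_def b'_def
  have split: "(\<Sum>j\<in>UNIV. h j) = (\<Sum>j\<in>S. h j) + (\<Sum>j\<in>-S. h j)" for h :: "'c \<Rightarrow> real"
    using sum.union_disjoint[of S "-S" h] by (simp add: Compl_partition)
  have ab: "(\<Sum>j\<in>UNIV. exp (s j)) = a + b" and ab': "(\<Sum>j\<in>UNIV. exp (s' j)) = a' + b'"
    by (simp_all add: defs split)
  let ?p = "\<Sum>j\<in>S. softmax s j" and ?p' = "\<Sum>j\<in>S. softmax s' j"
  have "(\<Sum>j\<in>UNIV. \<bar>softmax s j - softmax s' j\<bar>)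
      = (\<Sum>j\<in>S. softmax s' j - softmax s j) + (\<Sum>j\<in>-S. softmax s j - softmax s' j)"
    unfolding split by (intro arg_cong2[of _ _ _ _ "(+)"] sum.cong) (auto simp: S_def)
  also have "\<dots> = 2 * (?p' - ?p)"
    using sum_softmax[of s] sum_softmax[of s'] unfolding split by (simp add: sum_subtractf)
  finally have "total_variation (softmax s) (softmax s') = ?p' - ?p"
    by (simp add: total_variation_def)
  also have "\<dots> = a' / (a' + b') - a / (a + b)"
    by (simp add: softmax_def ab ab' a_def a'_def flip: sum_divide_distrib)
  also have "\<dots> \<le> (exp d - 1) / (exp d + 1)"
  proof (rule proportion_diff_le)
    show "a \<ge> 0" "b \<ge> 0" "a' \<ge> 0" "b' \<ge> 0" by (auto simp: defs intro: sum_nonneg)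
    show "a + b > 0" "a' + b' > 0"
      using sum_exp_pos[of s] sum_exp_pos[of s'] ab ab' by simp_all
    show "exp d \<ge> 1" using d0 by simp
    \<comment> \<open>At worst \<open>S\<close> gains a factor \<open>exp d\<close> and its
      complement loses one, hence the square. The product form of the odds bound also covers empty
      \<open>S\<close>.\<close>
    have "exp (s' j) \<le> exp d * exp (s j)" "exp (s j) \<le> exp d * exp (s' j)" for j
      using assms[of j] by (simp_all flip: exp_add)
    hence "a' \<le> exp d * a" "b \<le> exp d * b'"
      unfolding defs sum_distrib_left by (intro sum_mono; simp)+
    hence "a' * b \<le> (exp d * a) * (exp d * b')"
      using \<open>b \<ge> 0\<close> \<open>a \<ge> 0\<close> by (intro mult_mono) auto
    thus "a' * b \<le> (exp d)\<^sup>2 * (a * b')" by (simp add: power2_eq_square mult_ac)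
  qed
  finally show ?thesis by (simp add: tanh_half)
qed

text \<open>The intermediate point weights \<open>g\<close> by the softmax of \<open>s'\<close>, so
  that \<open>M\<close> has to bound \<open>g\<close> alone. The factor 2 undoes the half in total
  variation.\<close>

lemma norm_softmax_mean_diff_le:
  fixes g g' :: "'c::finite \<Rightarrow> 'a::real_normed_vector"
  assumes "\<And>j. norm (g j) \<le> M" "\<And>j. norm (g' j - g j) \<le> \<alpha>"
  shows "norm ((\<Sum>j\<in>UNIV. softmax s' j *\<^sub>R g' j) - (\<Sum>j\<in>UNIV. softmax s j *\<^sub>R g j))
    \<le> 2 * total_variation (softmax s) (softmax s') * M + \<alpha>"
proof -
  have "(\<Sum>j\<in>UNIV. softmax s' j *\<^sub>R g' j) - (\<Sum>j\<in>UNIV. softmax s j *\<^sub>R g j)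
      = (\<Sum>j\<in>UNIV. softmax s' j *\<^sub>R (g' j - g j)) + (\<Sum>j\<in>UNIV. (softmax s' j - softmax s j) *\<^sub>R g j)"
    by (simp add: scaleR_diff_right scaleR_diff_left sum_subtractf)
  also have "norm \<dots> \<le> (\<Sum>j\<in>UNIV. softmax s' j * \<alpha>) + (\<Sum>j\<in>UNIV. \<bar>softmax s j - softmax s' j\<bar> * M)"
    using assms
    by (intro norm_triangle_mono sum_norm_le)
       (auto simp: softmax_nonneg abs_minus_commute intro!: mult_left_mono)
  also have "\<dots> = 2 * total_variation (softmax s) (softmax s') * M + \<alpha>"
    by (simp add: total_variation_def sum_softmax flip: sum_distrib_right)
  finally show ?thesis .
qed

section \<open>Top-two margin and stability of the maximiser\<close>

lemma top_two_margin_attained: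
  fixes s :: "'c::finite \<Rightarrow> real"
  assumes "CARD('c) \<ge> 2"
  obtains j where "\<And>i. i \<noteq> j \<Longrightarrow> s j - s i \<ge> top_two_margin s"
proof -
  have "Max (range s) \<in> range s" by (intro Max_in) auto
  then obtain j where j: "s j = Max (range s)" by (auto simp: image_iff)
  \<comment> \<open>Deleting one copy of the maximum leaves the entries of all classes other than
    \<open>j\<close>, including any tied one.\<close>
  have U: "mset_set UNIV = add_mset j (mset_set (UNIV - {j}))"
    using mset_set.remove[of UNIV j] by simp
  have "image_mset s (mset_set UNIV) - {#s j#} = image_mset s (mset_set (UNIV - {j}))"
    by (subst U) simp
  hence m: "top_two_margin s = s j - Max (s ` (UNIV - {j}))"
    by (simp add: top_two_margin_def Let_def j)
  show thesis
  proof (rule that)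
    fix i assume "i \<noteq> j"
    hence "s i \<le> Max (s ` (UNIV - {j}))" by (intro Max_ge) auto
    thus "s j - s i \<ge> top_two_margin s" using m by linarith
  qed
qed

lemma argmax_set_eq_singletonI:
  assumes "\<And>i. i \<noteq> j \<Longrightarrow> s i < s j"
  shows "argmax_set s = {j}"
proof -
  have "\<not> s i > s j" for i using assms[of i] by (cases "i = j") auto
  thus ?thesis using assms by (auto simp: argmax_set_def is_arg_max_def)
qed

text \<open>The winner leads every rival by more than \<open>2 * d\<close>, and each of the two
  scores moves by at most \<open>d\<close>.\<close>

lemma argmax_set_perturb:
  fixes s s' :: "'c::finite \<Rightarrow> real"
  assumes "CARD('c) \<ge> 2" "\<And>j. \<bar>s' j - s j\<bar> \<le> d" "top_two_margin s > 2 * d"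
  shows "\<exists>j. argmax_set s = {j} \<and> argmax_set s' = {j}"
proof -
  obtain j where j: "\<And>i. i \<noteq> j \<Longrightarrow> s j - s i \<ge> top_two_margin s"
    using top_two_margin_attained[OF assms(1)] by blast
  have "s i < s j \<and> s' i < s' j" if "i \<noteq> j" for i
    using j[OF that] assms(2)[of i] assms(2)[of j] assms(3) by (auto simp: abs_le_iff)
  thus ?thesis using argmax_set_eq_singletonI[of j] by blast
qed

section \<open>Integrating the derivative error\<close>

text \<open>\<open>B - A\<close> is a derivative, possibly discontinuous; the gauge integral still
  integrates it, and the fundamental theorem itself supplies integrability.\<close>

lemma abs_diff_le_integral_segment:
  fixes F G A B e :: "real \<Rightarrow> real"
  assumes F: "\<And>x. x \<ge> 0 \<Longrightarrow> (F has_real_derivative A x) (at x within {0..})"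
    and G: "\<And>x. x \<ge> 0 \<Longrightarrow> (G has_real_derivative B x) (at x within {0..})"
    and "x \<ge> 0" "y \<ge> 0"
    and e: "e integrable_on {min x y..max x y}"
    and le: "\<And>t. t \<in> {min x y..max x y} \<Longrightarrow> \<bar>B t - A t\<bar> \<le> e t"
  shows "\<bar>(F y - F x) - (G y - G x)\<bar> \<le> integral {min x y..max x y} e"
proof -
  let ?l = "min x y" and ?u = "max x y"
  have "((\<lambda>t. G t - F t) has_real_derivative B t - A t) (at t within {?l..?u})"
    if "t \<in> {?l..?u}" for t
    using that assms(3,4) by (intro DERIV_diff DERIV_subset[OF F] DERIV_subset[OF G]) auto
  hence "((\<lambda>t. B t - A t) has_integral (G ?u - F ?u) - (G ?l - F ?l)) {?l..?u}"
    by (intro fundamental_theorem_of_calculus)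
       (auto simp: has_real_derivative_iff_has_vector_derivative)
  moreover from this have "norm (integral {?l..?u} (\<lambda>t. B t - A t)) \<le> integral {?l..?u} e"
    using le by (intro integral_norm_bound_integral e) (auto simp: integrable_on_def)
  ultimately have "\<bar>(G ?u - F ?u) - (G ?l - F ?l)\<bar> \<le> integral {?l..?u} e"
    by (simp add: integral_unique)
  \<comment> \<open>Exchanging the endpoints only changes a sign inside the absolute value.\<close>
  thus ?thesis by (cases "x \<le> y") (auto simp: min_def max_def)
qed

section \<open>Combination of the estimates for the Bessel potential and its surrogate\<close>

theorem proposition1:
  fixes \<mu> :: "'c::finite \<Rightarrow> real ^ 'p"
    and k c a r q qh D :: "'c \<Rightarrow> real"
    and \<tau> \<nu> d :: real
    and f :: "real ^ 'p"
    and y :: 'c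
    and F A e :: "real \<Rightarrow> real"
  assumes "CARD('p) \<ge> 5"
    and "\<nu> = real CARD('p) / 2 - 1"
    and "\<And>x. x \<ge> 0 \<Longrightarrow> (F has_real_derivative A x) (at x within {0..})"
    and "A 0 = 0"
    and "CARD('c) \<ge> 2"
    and "\<And>j. norm (\<mu> j) = 1"
    and "\<And>j. k j \<ge> 0"
    and "\<tau> > 0"
    and "r = radius \<mu> k \<tau> f"
    and "q = scores (bessel_potential \<nu>) \<mu> k c \<tau> f"
    and "qh = scores F \<mu> k c \<tau> f"
    and "\<And>j x. x \<in> {min (k j) (r j)..max (k j) (r j)} \<Longrightarrow> e x \<ge> 0"
    and "\<And>j. e integrable_on {min (k j) (r j)..max (k j) (r j)}"
    and "\<And>j x. x \<in> {min (k j) (r j)..max (k j) (r j)} \<Longrightarrow> \<bar>bessel_ratio \<nu> x - A x\<bar> \<le> e x"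
    and "\<And>j. D j = integral {min (k j) (r j)..max (k j) (r j)} e"
    and "d = Max (range D)"
    and "\<And>j. \<bar>bessel_ratio \<nu> (r j) - A (r j)\<bar> \<le> a j"
  shows "\<bar>cross_entropy qh y - cross_entropy q y\<bar> \<le> D y + d
    \<and> total_variation (softmax q) (softmax qh) \<le> tanh (d / 2)
    \<and> (\<exists>g gh.
          GDERIV (\<lambda>u. cross_entropy (scores (bessel_potential \<nu>) \<mu> k c \<tau> u) y) f :> g
        \<and> GDERIV (\<lambda>u. cross_entropy (scores F \<mu> k c \<tau> u) y) f :> gh
        \<and> norm (gh - g) \<le> (2 * tanh (d / 2) + Max (range a) + a y) / \<tau>)
    \<and> (top_two_margin qh > 2 * d \<or> top_two_margin q > 2 * d \<longrightarrow>
        (\<exists>j. argmax_set q = {j} \<and> argmax_set qh = {j}))"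
proof (intro conjI impI)
  have \<nu>: "\<nu> \<ge> 0" using assms(1,2) by simp
  note F = assms(3) and \<Phi> = bessel_potential_has_real_derivative[OF \<nu>]
  have r0: "r j \<ge> 0" for j by (simp add: assms(9) radius_def)
  \<comment> \<open>The offsets \<open>c j\<close> cancel, leaving the increments of the two
    potentials from \<open>k j\<close> to \<open>r j\<close>.\<close>
  have qD: "\<bar>qh j - q j\<bar> \<le> D j" for j
    using abs_diff_le_integral_segment[OF F \<Phi> assms(7) r0 assms(13,14)]
    by (simp add: assms(9,10,11,15) scores_def)
  have Dd: "D j \<le> d" for j by (simp add: assms(16))
  have qd: "\<bar>qh j - q j\<bar> \<le> d" for j using qD[of j] Dd[of j] by linarith
  show "\<bar>cross_entropy qh y - cross_entropy q y\<bar> \<le> D y + d"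
    using qD Dd by (rule cross_entropy_perturb)
  show TV: "total_variation (softmax q) (softmax qh) \<le> tanh (d / 2)"
    using qd by (rule total_variation_softmax_le)

  define v where "v j = k j *\<^sub>R \<mu> j + f /\<^sub>R \<tau>" for j
  \<comment> \<open>Both gradients point along the same \<open>sgn (v j)\<close>, so their
    difference is a scalar error; at \<open>v j = 0\<close> both vanish.\<close>
  define g where "g j = (bessel_ratio \<nu> (r j) / \<tau>) *\<^sub>R sgn (v j)" for j
  define gh where "gh j = (A (r j) / \<tau>) *\<^sub>R sgn (v j)" for j
  have sgn_le: "norm (x *\<^sub>R sgn (v j)) \<le> \<bar>x\<bar>" for x j
    by (simp add: norm_sgn)
  have g_le: "norm (g j) \<le> 1 / \<tau>" for j
    using order_trans[OF sgn_le, of "bessel_ratio \<nu> (r j) / \<tau>" "1 / \<tau>" j]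
      bessel_ratio_abs_le_1[OF \<nu> r0, of j] assms(8)
    by (simp add: g_def divide_right_mono)
  have diff_le: "norm (gh j - g j) \<le> a j / \<tau>" for j
  proof -
    have "gh j - g j = ((A (r j) - bessel_ratio \<nu> (r j)) / \<tau>) *\<^sub>R sgn (v j)"
      by (simp add: g_def gh_def diff_divide_distrib scaleR_diff_left)
    also have "norm \<dots> \<le> \<bar>A (r j) - bessel_ratio \<nu> (r j)\<bar> / \<tau>"
      using order_trans[OF sgn_le order_refl] assms(8) by (metis abs_divide abs_of_pos)
    also have "\<dots> \<le> a j / \<tau>"
      using assms(8) assms(17)[of j] by (intro divide_right_mono) (auto simp: abs_minus_commute)
    finally show ?thesis .
  qed
  have diff_le_Max: "norm (gh j - g j) \<le> Max (range a) / \<tau>" for j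
  proof -
    have "a j / \<tau> \<le> Max (range a) / \<tau>" using assms(8) by (intro divide_right_mono) auto
    with diff_le[of j] show ?thesis by linarith
  qed
  let ?m = "\<Sum>j\<in>UNIV. softmax q j *\<^sub>R g j" and ?mh = "\<Sum>j\<in>UNIV. softmax qh j *\<^sub>R gh j"
  \<comment> \<open>The softmax mean costs the maximum of \<open>a\<close>, while the separate term
    of class \<open>y\<close> costs only \<open>a y\<close>.\<close>
  have "norm ((?mh - gh y) - (?m - g y)) \<le> norm (?mh - ?m) + norm (gh y - g y)"
    using norm_triangle_ineq4[of "?mh - ?m" "gh y - g y"] by (simp add: algebra_simps)
  also have "\<dots> \<le> (2 * total_variation (softmax q) (softmax qh) * (1 / \<tau>) + Max (range a) / \<tau>) + a y / \<tau>"
    by (intro add_mono norm_softmax_mean_diff_le g_le diff_le_Max diff_le)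
  also have "\<dots> \<le> (2 * tanh (d / 2) + Max (range a) + a y) / \<tau>"
    using TV assms(8) by (simp add: add_divide_distrib divide_right_mono)
  finally have "norm ((?mh - gh y) - (?m - g y)) \<le> (2 * tanh (d / 2) + Max (range a) + a y) / \<tau>" .
  moreover have "GDERIV (\<lambda>u. cross_entropy (scores (bessel_potential \<nu>) \<mu> k c \<tau> u) y) f :> ?m - g y"
    unfolding assms(10) g_def v_def assms(9)
    by (intro GDERIV_cross_entropy GDERIV_scores[where B = "bessel_ratio \<nu>"] \<Phi> bessel_ratio_zero \<nu>)
  moreover have "GDERIV (\<lambda>u. cross_entropy (scores F \<mu> k c \<tau> u) y) f :> ?mh - gh y"
    unfolding assms(11) gh_def v_def assms(9)
    by (intro GDERIV_cross_entropy GDERIV_scores[where B = A] F assms(4))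
  ultimately show "\<exists>g gh.
          GDERIV (\<lambda>u. cross_entropy (scores (bessel_potential \<nu>) \<mu> k c \<tau> u) y) f :> g
        \<and> GDERIV (\<lambda>u. cross_entropy (scores F \<mu> k c \<tau> u) y) f :> gh
        \<and> norm (gh - g) \<le> (2 * tanh (d / 2) + Max (range a) + a y) / \<tau>"
    by blast

  have qd': "\<bar>q j - qh j\<bar> \<le> d" for j using qd[of j] by linarith
  assume "top_two_margin qh > 2 * d \<or> top_two_margin q > 2 * d"
  thus "\<exists>j. argmax_set q = {j} \<and> argmax_set qh = {j}"
    \<comment> \<open>The score bound is symmetric, so either score vector can play the one with the
      large margin.\<close>
    using argmax_set_perturb[OF assms(5), of qh q d] argmax_set_perturb[OF assms(5), of q qh d]
      qd qd' by blast
qed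

end
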